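(* Let $\varrho\colon C\to[0,1]$ be a default risk measure and let $F\colon \mathrm{B}_{\mathrm b}\to\mathbb{R}$ be monotone and compatible with $\varrho$. Then $\varrho_F\colon \mathrm{B}_{\mathrm b}\to\mathbb{R}$, given by \[ \varrho_F(X):=\inf\big\{\varrho(X_0)\,\big|\, X_0\in C,\ F(X-X_0)\le 0\big\}\quad\text{for all }X\in \mathrm{B}_{\mathrm b}, \] defines a default risk measure on $\mathrm{B}_{\mathrm b}$ with $\varrho_F(X)=\varrho(X)$ for all $X\in C$.
   Context: $(\Omega,\mathcal F)$ is a measurable space ($\Omega\neq\emptyset$) and $\mathrm{B}_{\mathrm b}$ is the space of all bounded measurable functions $\Omega\to\mathbb{R}$, ordered pointwise; real constants are identified with constant functions. $C\subset \mathrm{B}_{\mathrm b}$ is a set containing all constant functions. For a set $D\subset \mathrm{B}_{\mathrm b}$ containing all constant functions, a map $\varrho\colon D\to[0,1]$ is a default risk measure (on $D$) if (i) $\varrho(X)\le\varrho(Y)$ for all $X,Y\in D$ with $X\le Y$, and (ii) $\varrho(0)=0$ and $\varrho(m)=1$ for all real $m>0$. A map $F\colon \mathrm{B}_{\mathrm b}\to\mathbb{R}$ is monotone if $F(X)\le F(Y)$ for all $X,Y\in \mathrm{B}_{\mathrm b}$ with $X\le Y$. It is compatible with a default risk measure $\varrho\colon C\to[0,1]$ if $F(0)=0$ and, for all $X,Y\in C$, $F(X-Y)\le 0$ implies $\varrho(X)\le\varrho(Y)$. *)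

theory Defs
  imports "HOL-Analysis.Analysis"
begin

text \<open>
  The measurable space is the one underlying M; the measure carried by M plays no role.
  Functions on \<open>space M\<close> are represented by total functions, and the pointwise order looks
  only at \<open>space M\<close>. Maps monotone for this order are therefore insensitive to the values
  of their arguments outside \<open>space M\<close>.
\<close>

definition bounded_measurable :: "'a measure \<Rightarrow> ('a \<Rightarrow> real) set" where
  "bounded_measurable M = {X \<in> borel_measurable M. bounded (X ` space M)}"

definition pointwise_le :: "'a measure \<Rightarrow> ('a \<Rightarrow> real) \<Rightarrow> ('a \<Rightarrow> real) \<Rightarrow> bool" where
  "pointwise_le M X Y \<longleftrightarrow> (\<forall>\<omega>\<in>space M. X \<omega> \<le> Y \<omega>)"

definition default_risk_measure ::
    "'a measure \<Rightarrow> ('a \<Rightarrow> real) set \<Rightarrow> (('a \<Rightarrow> real) \<Rightarrow> real) \<Rightarrow> bool" where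
  "default_risk_measure M D \<rho> \<longleftrightarrow>
     (\<forall>X\<in>D. \<rho> X \<in> {0..1}) \<and>
     (\<forall>X\<in>D. \<forall>Y\<in>D. pointwise_le M X Y \<longrightarrow> \<rho> X \<le> \<rho> Y) \<and>
     \<rho> (\<lambda>_. 0) = 0 \<and> (\<forall>m>0. \<rho> (\<lambda>_. m) = 1)"

definition monotone_functional :: "'a measure \<Rightarrow> (('a \<Rightarrow> real) \<Rightarrow> real) \<Rightarrow> bool" where
  "monotone_functional M F \<longleftrightarrow>
     (\<forall>X\<in>bounded_measurable M. \<forall>Y\<in>bounded_measurable M.
        pointwise_le M X Y \<longrightarrow> F X \<le> F Y)"

definition compatible ::
    "('a \<Rightarrow> real) set \<Rightarrow> (('a \<Rightarrow> real) \<Rightarrow> real) \<Rightarrow> (('a \<Rightarrow> real) \<Rightarrow> real) \<Rightarrow> bool" where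
  "compatible C \<rho> F \<longleftrightarrow>
     F (\<lambda>_. 0) = 0 \<and>
     (\<forall>X\<in>C. \<forall>Y\<in>C. F (\<lambda>\<omega>. X \<omega> - Y \<omega>) \<le> 0 \<longrightarrow> \<rho> X \<le> \<rho> Y)"

text \<open>
  The infimum is the one of the reals. For \<open>X\<close> bounded and measurable, \<open>F\<close> monotone
  with \<open>F 0 = 0\<close>, and \<open>C\<close> containing the constants, the set is nonempty (take a constant
  upper bound of \<open>X\<close>), so the value of \<open>Inf\<close> at the empty set is irrelevant.
\<close>

definition risk_extension ::
    "('a \<Rightarrow> real) set \<Rightarrow> (('a \<Rightarrow> real) \<Rightarrow> real) \<Rightarrow> (('a \<Rightarrow> real) \<Rightarrow> real) \<Rightarrow>
     ('a \<Rightarrow> real) \<Rightarrow> real" where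
  "risk_extension C \<rho> F X = Inf {\<rho> X0 | X0. X0 \<in> C \<and> F (\<lambda>\<omega>. X \<omega> - X0 \<omega>) \<le> 0}"

end

theory Submission
  imports Defs
begin

text \<open>Call \<open>X0\<close> in \<open>C\<close> admissible for \<open>X\<close> if
  \<open>F\<close> is at most 0 at \<open>X - X0\<close>; the extension is the infimum of
  \<open>\<rho>\<close> over admissible elements. On \<open>C\<close> this infimum is a minimum
  attained at \<open>X\<close> itself (\<open>risk_extension_eq\<close>), so the extension agrees
  with \<open>\<rho>\<close> there and, constants being in \<open>C\<close>, inherits its
  normalisation. Since \<open>F\<close> is monotone, raising \<open>X\<close> can only remove
  admissible elements (\<open>A_anti\<close>), so the infimum can only grow. Its values stay between
  0 and 1 because it is taken over a nonempty set of such numbers: a constant dominating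
  \<open>X\<close> is always admissible (\<open>A_nonempty\<close>).\<close>

lemma bounded_measurable_diff:
  assumes "X \<in> bounded_measurable M" "Y \<in> bounded_measurable M"
  shows "(\<lambda>\<omega>. X \<omega> - Y \<omega>) \<in> bounded_measurable M"
  using assms unfolding bounded_measurable_def
  by (auto intro: bounded_minus_comp)

lemma bounded_measurable_upper_bound:
  assumes "X \<in> bounded_measurable M"
  obtains c where "\<And>\<omega>. \<omega> \<in> space M \<Longrightarrow> X \<omega> \<le> c"
proof -
  from assms obtain c where "\<forall>x\<in>X ` space M. norm x \<le> c"
    unfolding bounded_measurable_def bounded_iff by blast
  then have "X \<omega> \<le> c" if "\<omega> \<in> space M" for \<omega>
    using that by (auto dest: abs_le_D1)
  then show thesis by (rule that)
qed

text \<open>\<open>X\<close> is admissible for itself because \<open>F\<close> vanishes at 0, and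
  compatibility says precisely that \<open>\<rho> X\<close> is a lower bound for
  \<open>\<rho>\<close> over the admissible elements.\<close>

lemma risk_extension_eq:
  assumes comp: "compatible C \<rho> F" and X: "X \<in> C"
  shows "risk_extension C \<rho> F X = \<rho> X"
  unfolding risk_extension_def
proof (rule cInf_eq_minimum)
  show "\<rho> X \<in> {\<rho> X0 |X0. X0 \<in> C \<and> F (\<lambda>\<omega>. X \<omega> - X0 \<omega>) \<le> 0}"
    using comp X by (auto simp: compatible_def intro!: exI[of _ X])
qed (use comp X in \<open>auto simp: compatible_def\<close>)

theorem theorem10:
  fixes M :: "'a measure"
    and C :: "('a \<Rightarrow> real) set"
    and \<rho> F :: "('a \<Rightarrow> real) \<Rightarrow> real"
  assumes "space M \<noteq> {}"
    and "C \<subseteq> bounded_measurable M"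
    and "\<And>m::real. (\<lambda>_. m) \<in> C"
    and "default_risk_measure M C \<rho>"
    and "monotone_functional M F"
    and "compatible C \<rho> F"
  shows "default_risk_measure M (bounded_measurable M) (risk_extension C \<rho> F) \<and>
         (\<forall>X\<in>C. risk_extension C \<rho> F X = \<rho> X)"
proof -
  define A where "A X = {\<rho> X0 | X0. X0 \<in> C \<and> F (\<lambda>\<omega>. X \<omega> - X0 \<omega>) \<le> 0}" for X
  have ext: "risk_extension C \<rho> F X = Inf (A X)" for X
    by (simp add: risk_extension_def A_def)
  have \<rho>: "\<And>X. X \<in> C \<Longrightarrow> 0 \<le> \<rho> X \<and> \<rho> X \<le> 1" "\<rho> (\<lambda>_. 0) = 0"
    "\<And>m. m > 0 \<Longrightarrow> \<rho> (\<lambda>_. m) = 1"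
    using assms(4) by (auto simp: default_risk_measure_def)
  have F0: "F (\<lambda>_. 0) = 0"
    using assms(6) by (simp add: compatible_def)
  have F_mono: "F X \<le> F Y"
    if "X \<in> bounded_measurable M" "Y \<in> bounded_measurable M" "pointwise_le M X Y" for X Y
    using assms(5) that by (simp add: monotone_functional_def)
  have A_bounds: "a \<in> {0..1}" if "a \<in> A X" for a X
    using that \<rho>(1) by (auto simp: A_def)
  then have A_bdd: "bdd_below (A X)" for X
    by (meson atLeastAtMost_iff bdd_belowI)
  have A_nonempty: "A X \<noteq> {}" if X: "X \<in> bounded_measurable M" for X
  proof -
    \<comment> \<open>The constant \<open>c\<close> serves as an admissible element:
      \<open>X - c\<close> is nonpositive on \<open>space M\<close>, so monotonicity compares its
      \<open>F\<close>-value with that of 0.\<close>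
    obtain c where c: "\<And>\<omega>. \<omega> \<in> space M \<Longrightarrow> X \<omega> \<le> c"
      using bounded_measurable_upper_bound[OF X] by blast
    have "F (\<lambda>\<omega>. X \<omega> - c) \<le> F (\<lambda>_. 0)"
    proof (rule F_mono)
      show "(\<lambda>\<omega>. X \<omega> - c) \<in> bounded_measurable M"
        using bounded_measurable_diff[OF X] assms(2,3) by blast
      show "(\<lambda>_. 0) \<in> bounded_measurable M"
        using assms(2,3) by blast
      show "pointwise_le M (\<lambda>\<omega>. X \<omega> - c) (\<lambda>_. 0)"
        using c by (simp add: pointwise_le_def)
    qed
    then have "\<rho> (\<lambda>_. c) \<in> A X"
      using assms(3) F0 by (auto simp: A_def)
    then show ?thesis by blast
  qed
  \<comment> \<open>An element admissible for the larger \<open>Y\<close> stays admissible for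
    \<open>X\<close>, since subtracting the same \<open>Z\<close> preserves the order.\<close>
  have A_anti: "A Y \<subseteq> A X"
    if XY: "X \<in> bounded_measurable M" "Y \<in> bounded_measurable M" "pointwise_le M X Y" for X Y
  proof
    fix a assume "a \<in> A Y"
    then obtain Z where Z: "a = \<rho> Z" "Z \<in> C" "F (\<lambda>\<omega>. Y \<omega> - Z \<omega>) \<le> 0"
      by (auto simp: A_def)
    have "F (\<lambda>\<omega>. X \<omega> - Z \<omega>) \<le> F (\<lambda>\<omega>. Y \<omega> - Z \<omega>)"
      using XY Z(2) assms(2)
      by (intro F_mono bounded_measurable_diff) (auto simp: pointwise_le_def)
    with Z show "a \<in> A X"
      by (auto simp: A_def)
  qed
  have "Inf (A X) \<in> {0..1}" if X: "X \<in> bounded_measurable M" for X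
  proof -
    obtain a where a: "a \<in> A X"
      using A_nonempty[OF X] by blast
    have "0 \<le> Inf (A X)"
      using A_nonempty[OF X] A_bounds by (intro cInf_greatest) auto
    moreover have "Inf (A X) \<le> 1"
      using cInf_lower[OF a A_bdd] A_bounds[OF a] by simp
    ultimately show ?thesis by simp
  qed
  moreover have "Inf (A X) \<le> Inf (A Y)"
    if "X \<in> bounded_measurable M" "Y \<in> bounded_measurable M" "pointwise_le M X Y" for X Y
    using that by (intro cInf_superset_mono A_nonempty A_bdd A_anti)
  \<comment> \<open>The values at 0 and at positive constants come from agreement with
    \<open>\<rho>\<close> on \<open>C\<close>.\<close>
  ultimately show ?thesis
    using risk_extension_eq[OF assms(6)] assms(3) \<rho>(2,3)
    by (simp add: default_risk_measure_def flip: ext)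
qed

end
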